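(* Let $n$ be a positive integer and let $\mathbf{C}$ be the class of all potentially partial recursive $n$-ary functions. Let $\mathcal{A}$ be a finite collection of subsets of $\mathbb{N}^n$. Then $\mathcal{A}$ is strongly join permitting for $\mathbf{C}$ if and only if, for each subcollection $\mathcal{K}\subseteq\mathcal{A}$, some recursively enumerable subset $H_\mathcal{K}$ of $\mathbb{N}^n$ separates $\bigcup\mathcal{K}\setminus\bigcup(\mathcal{A}\setminus\mathcal{K})$ from $\bigcup(\mathcal{A}\setminus\mathcal{K})\setminus\bigcup\mathcal{K}$.
   Context: Functions are considered as sets of ordered pairs; $f\!\upharpoonright_A$ denotes the restriction of $f$ to $A\cap\mathrm{dom}(f)$. A partial function from $\mathbb{N}^n$ to $\mathbb{N}$ is potentially partial recursive if it is a restriction of some $n$-ary partial recursive function. For a class $\mathbf{C}$ of functions, a collection $\mathcal{A}$ of sets is strongly join permitting for $\mathbf{C}$ if for every function $f$ with $\mathrm{dom}(f)\subseteq\bigcup\mathcal{A}$: if $f\!\upharpoonright_A\in\mathbf{C}$ for all $A\in\mathcal{A}$, then $f\in\mathbf{C}$. For a collection $\mathcal{K}$ of sets, $\bigcup\mathcal{K}$ is the union of its members (empty if $\mathcal{K}=\varnothing$). A set $H$ separates $P$ from $Q$ if $H\supseteq P$ and $H\cap Q=\varnothing$. *)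

theory Defs
  imports Main
begin

definition tuples :: "nat \<Rightarrow> nat list set" where
  "tuples n = {xs. length xs = n}"

text \<open>
  Partial functions from \<open>\<nat>\<^sup>n\<close> to \<open>\<nat>\<close> are maps \<open>f :: nat list \<rightharpoonup> nat\<close> with \<open>dom f \<subseteq> tuples n\<close>.
  Composition is strict: it is undefined as soon as one of the inner functions is.
\<close>

definition comp_op ::
  "nat \<Rightarrow> (nat list \<rightharpoonup> nat) \<Rightarrow> (nat list \<rightharpoonup> nat) list \<Rightarrow> (nat list \<rightharpoonup> nat)" where
  "comp_op n g hs = (\<lambda>xs.
     if length xs = n \<and> (\<forall>h\<in>set hs. xs \<in> dom h) then g (map (\<lambda>h. the (h xs)) hs) else None)"

fun primrec_op ::
  "(nat list \<rightharpoonup> nat) \<Rightarrow> (nat list \<rightharpoonup> nat) \<Rightarrow> (nat list \<rightharpoonup> nat)" where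
  "primrec_op g h [] = None"
| "primrec_op g h (0 # xs) = g xs"
| "primrec_op g h (Suc k # xs) =
     (case primrec_op g h (k # xs) of None \<Rightarrow> None | Some y \<Rightarrow> h (k # y # xs))"

text \<open>
  Unbounded minimization \<open>\<mu>k. f(k, xs) = 0\<close>: the values of \<open>f\<close> below the zero found must all be
  defined.
\<close>

definition mu_op :: "nat \<Rightarrow> (nat list \<rightharpoonup> nat) \<Rightarrow> (nat list \<rightharpoonup> nat)" where
  "mu_op n f = (\<lambda>xs.
     if length xs = n \<and> (\<exists>k. f (k # xs) = Some 0 \<and> (\<forall>j<k. f (j # xs) \<noteq> None))
     then Some (LEAST k. f (k # xs) = Some 0) else None)"

text \<open>
  Arity \<open>0\<close> is allowed so that unary functions can be obtained by primitive recursion from a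
  constant.
\<close>

inductive partial_recursive :: "nat \<Rightarrow> (nat list \<rightharpoonup> nat) \<Rightarrow> bool" where
  zero: "partial_recursive n (\<lambda>xs. if length xs = n then Some 0 else None)"
| succ: "partial_recursive 1 (\<lambda>xs. if length xs = 1 then Some (Suc (xs ! 0)) else None)"
| proj: "i < n \<Longrightarrow> partial_recursive n (\<lambda>xs. if length xs = n then Some (xs ! i) else None)"
| comp: "partial_recursive (length hs) g \<Longrightarrow> (\<And>h. h \<in> set hs \<Longrightarrow> partial_recursive n h) \<Longrightarrow>
    partial_recursive n (comp_op n g hs)"
| prim_rec: "partial_recursive n g \<Longrightarrow> partial_recursive (Suc (Suc n)) h \<Longrightarrow>
    partial_recursive (Suc n) (primrec_op g h)"
| mu: "partial_recursive (Suc n) f \<Longrightarrow> partial_recursive n (mu_op n f)"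

lemma dom_primrec_op:
  assumes "dom g \<subseteq> tuples n" "dom h \<subseteq> tuples (Suc (Suc n))"
  shows "dom (primrec_op g h) \<subseteq> tuples (Suc n)"
proof
  fix xs assume "xs \<in> dom (primrec_op g h)"
  then show "xs \<in> tuples (Suc n)"
    using assms
    by (induction g h xs rule: primrec_op.induct)
       (fastforce simp: tuples_def dom_def split: option.splits)+
qed

lemma dom_partial_recursive: "partial_recursive n f \<Longrightarrow> dom f \<subseteq> tuples n"
proof (induction rule: partial_recursive.induct)
  case (prim_rec n g h)
  then show ?case by (blast dest: dom_primrec_op)
qed (auto simp: tuples_def comp_op_def mu_op_def split: if_splits)

definition potentially_partial_recursive :: "nat \<Rightarrow> (nat list \<rightharpoonup> nat) \<Rightarrow> bool" where
  "potentially_partial_recursive n f \<longleftrightarrow> (\<exists>g D. partial_recursive n g \<and> f = g |` D)"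

definition recursively_enumerable :: "nat \<Rightarrow> nat list set \<Rightarrow> bool" where
  "recursively_enumerable n H \<longleftrightarrow> (\<exists>g. partial_recursive n g \<and> H = dom g)"

definition strongly_join_permitting :: "('a \<rightharpoonup> 'b) set \<Rightarrow> 'a set set \<Rightarrow> bool" where
  "strongly_join_permitting C \<A> \<longleftrightarrow>
     (\<forall>f. dom f \<subseteq> \<Union>\<A> \<longrightarrow> (\<forall>A\<in>\<A>. f |` A \<in> C) \<longrightarrow> f \<in> C)"

definition separates :: "'a set \<Rightarrow> 'a set \<Rightarrow> 'a set \<Rightarrow> bool" where
  "separates H P Q \<longleftrightarrow> P \<subseteq> H \<and> H \<inter> Q = {}"

end

theory Submission imports Defs HOL.Filter begin

text \<open>
  If \<open>\<A>\<close> is strongly join permitting, a recursive extension \<open>g\<close> of the function that is \<open>0\<close> on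
  \<open>\<Union>\<K> - \<Union>(\<A> - \<K>)\<close> and \<open>1\<close> on \<open>\<Union>(\<A> - \<K>) - \<Union>\<K>\<close> gives the separating set \<open>{x. g x = Some 0}\<close>.
  Conversely, let \<open>G A\<close> be a recursive extension of \<open>f\<close> restricted to \<open>A\<close>. On input \<open>x\<close>, search for a
  nonempty \<open>\<K>\<close> and a value \<open>y\<close> with \<open>G A x = y\<close> for all \<open>A \<in> \<K>\<close> and \<open>x\<close> in the separating set of \<open>\<K>\<close>,
  and output \<open>y\<close>. If \<open>x \<in> dom f\<close>, then \<open>\<K> = {A. G A x = f x}\<close> contains every \<open>A\<close> with \<open>x \<in> A\<close>, so the
  search succeeds; a \<open>\<K>\<close> giving a wrong value contains no such \<open>A\<close>, so its separating set omits \<open>x\<close>.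
  The parallel search is recursive because every partial recursive function is the limit of a
  total recursive sequence of finite-stage approximations.
\<close>

section \<open>Closure properties of total recursive functions\<close>

text \<open>Ordinary functions on lists keep the closure proofs free of \<open>option\<close>.
  Values on lists of other lengths are immaterial, as \<open>total_recursive_cong\<close>
  records.\<close>

definition total_recursive :: "nat \<Rightarrow> (nat list \<Rightarrow> nat) \<Rightarrow> bool" where
  "total_recursive n F \<longleftrightarrow>
     partial_recursive n (\<lambda>xs. if length xs = n then Some (F xs) else None)"

lemma total_recursive_cong:
  assumes "total_recursive n F" "\<And>xs. length xs = n \<Longrightarrow> F xs = G xs"
  shows "total_recursive n G"
proof -
  have "(\<lambda>xs. if length xs = n then Some (F xs) else None)
      = (\<lambda>xs. if length xs = n then Some (G xs) else None)"
    using assms(2) by auto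
  then show ?thesis using assms(1) by (simp add: total_recursive_def)
qed

lemma total_recursive_nth: "i < n \<Longrightarrow> total_recursive n (\<lambda>xs. xs ! i)"
  unfolding total_recursive_def by (rule partial_recursive.proj)

lemma total_recursive_hd: "total_recursive (Suc n) hd"
  by (rule total_recursive_cong[OF total_recursive_nth[of 0]]) (auto simp: length_Suc_conv)

lemma total_recursive_comp:
  assumes "total_recursive (length hs) g" "\<forall>h\<in>set hs. total_recursive n h"
  shows "total_recursive n (\<lambda>xs. g (map (\<lambda>h. h xs) hs))"
proof -
  let ?t = "\<lambda>h xs. if length xs = n then Some (h xs) else None"
  have "partial_recursive n
      (comp_op n (\<lambda>xs. if length xs = length hs then Some (g xs) else None) (map ?t hs))"
    using assms by (intro partial_recursive.comp) (auto simp: total_recursive_def)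
  also have "comp_op n (\<lambda>xs. if length xs = length hs then Some (g xs) else None) (map ?t hs)
      = (\<lambda>xs. if length xs = n then Some (g (map (\<lambda>h. h xs) hs)) else None)"
    by (auto simp: comp_op_def fun_eq_iff o_def dom_def)
  finally show ?thesis by (simp add: total_recursive_def)
qed

lemma total_recursive_Suc: "total_recursive n F \<Longrightarrow> total_recursive n (\<lambda>xs. Suc (F xs))"
  using total_recursive_comp[of "[F]" "\<lambda>xs. Suc (xs ! 0)" n] partial_recursive.succ
  by (simp add: total_recursive_def)

lemma total_recursive_const: "total_recursive n (\<lambda>xs. c)"
proof (induction c)
  case 0
  show ?case unfolding total_recursive_def by (rule partial_recursive.zero)
qed (rule total_recursive_Suc)

lemma total_recursive_rec_nat:
  assumes "total_recursive n g" "total_recursive (Suc (Suc n)) h"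
  shows "total_recursive (Suc n)
    (\<lambda>xs. rec_nat (g (tl xs)) (\<lambda>k y. h (k # y # tl xs)) (hd xs))"
proof -
  let ?g = "\<lambda>xs. if length xs = n then Some (g xs) else None"
  let ?h = "\<lambda>xs. if length xs = Suc (Suc n) then Some (h xs) else None"
  have eq: "primrec_op ?g ?h (k # xs)
      = (if length xs = n then Some (rec_nat (g xs) (\<lambda>k y. h (k # y # xs)) k) else None)" for k xs
    by (induction k) auto
  have "partial_recursive (Suc n) (primrec_op ?g ?h)"
    using assms by (intro partial_recursive.prim_rec) (auto simp: total_recursive_def)
  also have "primrec_op ?g ?h = (\<lambda>xs. if length xs = Suc n
      then Some (rec_nat (g (tl xs)) (\<lambda>k y. h (k # y # tl xs)) (hd xs)) else None)"
  proof
    fix xs show "primrec_op ?g ?h xs = (if length xs = Suc n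
      then Some (rec_nat (g (tl xs)) (\<lambda>k y. h (k # y # tl xs)) (hd xs)) else None)"
      using eq by (cases xs) auto
  qed
  finally show ?thesis by (simp add: total_recursive_def)
qed

lemma total_recursive_binary:
  assumes "total_recursive 2 (\<lambda>xs. f (hd xs) (xs ! 1))" "total_recursive n a" "total_recursive n b"
  shows "total_recursive n (\<lambda>xs. f (a xs) (b xs))"
  using total_recursive_comp[of "[a, b]" "\<lambda>xs. f (hd xs) (xs ! 1)" n] assms
  by (auto simp: numeral_2_eq_2)

lemma total_recursive_pred:
  assumes "total_recursive n a"
  shows "total_recursive n (\<lambda>xs. a xs - 1)"
proof -
  \<comment> \<open>The recursion step ignores the previous value and returns its counter, which is
    the predecessor of the argument reached.\<close>
  have "total_recursive 1 (\<lambda>xs. rec_nat 0 (\<lambda>k y. (k # y # tl xs) ! 0) (hd xs))"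
    using total_recursive_rec_nat[of 0 "\<lambda>_. 0" "\<lambda>xs. xs ! 0"]
    by (simp add: total_recursive_const total_recursive_nth)
  then have "total_recursive 1 (\<lambda>xs. hd xs - 1)"
  proof (rule total_recursive_cong)
    show "rec_nat 0 (\<lambda>k y. (k # y # tl xs) ! 0) (hd xs) = hd xs - 1" for xs :: "nat list"
      by (cases "hd xs") auto
  qed
  then show ?thesis
    using total_recursive_comp[of "[a]" "\<lambda>xs. hd xs - 1" n] assms by auto
qed

text \<open>Subtraction iterates the predecessor. The recursion runs on the first argument and so
  computes the difference in reversed order; \<open>total_recursive_binary\<close> swaps the
  arguments back.\<close>

lemma total_recursive_diff:
  assumes "total_recursive n a" "total_recursive n b"
  shows "total_recursive n (\<lambda>xs. a xs - b xs)"
proof -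
  have "total_recursive 2
      (\<lambda>xs. rec_nat (tl xs ! 0) (\<lambda>k y. (k # y # tl xs) ! 1 - 1) (hd xs))"
    using total_recursive_rec_nat[of 1 "\<lambda>xs. xs ! 0" "\<lambda>xs. xs ! 1 - 1"]
    by (simp add: total_recursive_nth total_recursive_pred numeral_2_eq_2 del: One_nat_def)
  then have "total_recursive 2 (\<lambda>xs. xs ! 1 - hd xs)"
  proof (rule total_recursive_cong)
    show "rec_nat (tl xs ! 0) (\<lambda>k y. (k # y # tl xs) ! 1 - 1) (hd xs) = xs ! 1 - hd xs"
      if "length xs = 2" for xs :: "nat list"
    proof -
      have "rec_nat (tl xs ! 0) (\<lambda>k y. (k # y # tl xs) ! 1 - 1) m = tl xs ! 0 - m" for m
        by (induction m) auto
      then show ?thesis using that by (simp add: nth_tl)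
    qed
  qed
  from total_recursive_binary[of "\<lambda>x y. y - x", OF this assms(2,1)] show ?thesis .
qed

text \<open>Case distinction is a primitive recursion on the condition: the base value is the first
  branch, and every step discards the previous value and returns the second branch.\<close>

lemma total_recursive_if:
  assumes "total_recursive n c" "total_recursive n a" "total_recursive n b"
  shows "total_recursive n (\<lambda>xs. if c xs = 0 then a xs else b xs)"
proof -
  have "total_recursive 3
      (\<lambda>xs. rec_nat (tl xs ! 0) (\<lambda>k y. (k # y # tl xs) ! 3) (hd xs))"
    using total_recursive_rec_nat[of 2 "\<lambda>xs. xs ! 0" "\<lambda>xs. xs ! 3"]
    by (simp add: total_recursive_nth eval_nat_numeral)
  then have "total_recursive 3 (\<lambda>xs. if hd xs = 0 then xs ! 1 else xs ! 2)"
  proof (rule total_recursive_cong)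
    show "rec_nat (tl xs ! 0) (\<lambda>k y. (k # y # tl xs) ! 3) (hd xs)
        = (if hd xs = 0 then xs ! 1 else xs ! 2)" if "length xs = 3" for xs :: "nat list"
      using that by (cases "hd xs") (auto simp: nth_tl eval_nat_numeral)
  qed
  then show ?thesis
    using total_recursive_comp[of "[c, a, b]" "\<lambda>xs. if hd xs = 0 then xs ! 1 else xs ! 2" n] assms
    by (simp add: eval_nat_numeral cong: if_cong)
qed

lemma total_recursive_if_all:
  assumes "\<And>h. h \<in> set hs \<Longrightarrow> total_recursive n h" "total_recursive n a"
  shows "total_recursive n (\<lambda>xs. if \<forall>h\<in>set hs. h xs \<noteq> 0 then a xs else 0)"
  using assms(1)
proof (induction hs)
  case (Cons h hs)
  have "total_recursive n
      (\<lambda>xs. if h xs = 0 then 0 else if \<forall>h\<in>set hs. h xs \<noteq> 0 then a xs else 0)"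
    using Cons by (intro total_recursive_if total_recursive_const) auto
  then show ?case by (rule total_recursive_cong) auto
qed (simp add: assms(2))

text \<open>Serves to permute, duplicate or insert leading arguments while a parameter list of
  length \<open>m\<close> is carried along: primitive recursion runs on the first argument, but a
  stage function has its stage there.\<close>

lemma total_recursive_subst:
  assumes "total_recursive (length es + m) F" "\<forall>e\<in>set es. total_recursive (k + m) e"
  shows "total_recursive (k + m) (\<lambda>xs. F (map (\<lambda>e. e xs) es @ drop k xs))"
proof -
  let ?ps = "map (\<lambda>i xs. xs ! i) [k..<k + m]"
  have "total_recursive (k + m) (\<lambda>xs. F (map (\<lambda>h. h xs) (es @ ?ps)))"
    using assms by (intro total_recursive_comp) (auto intro: total_recursive_nth)
  then show ?thesis
  proof (rule total_recursive_cong)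
    show "F (map (\<lambda>h. h xs) (es @ ?ps)) = F (map (\<lambda>e. e xs) es @ drop k xs)"
      if "length xs = k + m" for xs :: "nat list"
    proof -
      have "map (\<lambda>h. h xs) ?ps = drop k xs"
        using that by (intro nth_equalityI) auto
      then show ?thesis by (metis map_append)
    qed
  qed
qed

section \<open>Finite-stage approximations of partial recursive functions\<close>

text \<open>
  In a stage function the value \<open>0\<close> means ``no result yet'' and \<open>Suc y\<close> means ``result \<open>y\<close>''.
\<close>

definition stages :: "nat \<Rightarrow> (nat \<Rightarrow> nat list \<Rightarrow> nat) \<Rightarrow> (nat list \<rightharpoonup> nat) \<Rightarrow> bool" where
  "stages n F f \<longleftrightarrow> total_recursive (Suc n) (\<lambda>xs. F (hd xs) (tl xs)) \<and>
     (\<forall>xs s y. length xs = n \<longrightarrow> F s xs = Suc y \<longrightarrow> f xs = Some y) \<and>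
     (\<forall>xs y. length xs = n \<longrightarrow> f xs = Some y \<longrightarrow> (\<forall>\<^sub>F s in sequentially. F s xs = Suc y))"

lemma stagesI:
  assumes "total_recursive (Suc n) (\<lambda>xs. F (hd xs) (tl xs))"
    "\<And>xs s y. length xs = n \<Longrightarrow> F s xs = Suc y \<Longrightarrow> f xs = Some y"
    "\<And>xs y. length xs = n \<Longrightarrow> f xs = Some y \<Longrightarrow> \<forall>\<^sub>F s in sequentially. F s xs = Suc y"
  shows "stages n F f"
  using assms unfolding stages_def by blast

lemma stages_recursive: "stages n F f \<Longrightarrow> total_recursive (Suc n) (\<lambda>xs. F (hd xs) (tl xs))"
  and stages_sound: "stages n F f \<Longrightarrow> F s xs = Suc y \<Longrightarrow> length xs = n \<Longrightarrow> f xs = Some y"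
  and stages_complete: "stages n F f \<Longrightarrow> f xs = Some y \<Longrightarrow> length xs = n \<Longrightarrow>
      \<forall>\<^sub>F s in sequentially. F s xs = Suc y"
  unfolding stages_def by blast+

lemma stages_total:
  assumes "total_recursive n g"
  shows "stages n (\<lambda>s xs. Suc (g xs)) (\<lambda>xs. if length xs = n then Some (g xs) else None)"
proof (rule stagesI)
  have "total_recursive (Suc n) (\<lambda>xs. g (tl xs))"
    using total_recursive_subst[of "[]" n g 1] assms by (simp add: drop_Suc)
  then show "total_recursive (Suc n) (\<lambda>xs. Suc (g (tl xs)))" by (rule total_recursive_Suc)
qed auto

text \<open>Stage \<open>s\<close> runs the outer function only once all inner ones have results.
  There are finitely many inner functions, so from some stage on all show their final values;
  \<open>G\<close> is then evaluated at a fixed list, where it stabilises too.\<close>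

lemma stages_comp:
  assumes G: "stages (length hs) G g" and H: "\<And>h. h \<in> set hs \<Longrightarrow> stages n (H h) h"
  shows "stages n (\<lambda>s xs. if \<forall>h\<in>set hs. H h s xs \<noteq> 0
      then G s (map (\<lambda>h. H h s xs - 1) hs) else 0) (comp_op n g hs)"
proof (rule stagesI)
  let ?hs = "map (\<lambda>h xs. H h (hd xs) (tl xs)) hs"
  have hs: "total_recursive (Suc n) h" if "h \<in> set ?hs" for h
    using that H by (auto dest: stages_recursive)
  let ?es = "hd # map (\<lambda>h xs. H h (hd xs) (tl xs) - 1) hs"
  have "total_recursive (Suc n) (\<lambda>xs. G (hd (map (\<lambda>e. e xs) ?es)) (tl (map (\<lambda>e. e xs) ?es)))"
  proof (rule total_recursive_comp)
    show "total_recursive (length ?es) (\<lambda>xs. G (hd xs) (tl xs))"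
      using stages_recursive[OF G] by simp
    show "\<forall>e\<in>set ?es. total_recursive (Suc n) e"
      using stages_recursive[OF H]
      by (auto simp del: One_nat_def intro: total_recursive_hd total_recursive_pred)
  qed
  with hs have "total_recursive (Suc n) (\<lambda>xs. if \<forall>h\<in>set ?hs. h xs \<noteq> 0
      then G (hd (map (\<lambda>e. e xs) ?es)) (tl (map (\<lambda>e. e xs) ?es)) else 0)"
    by (rule total_recursive_if_all)
  then show "total_recursive (Suc n) (\<lambda>xs. if \<forall>h\<in>set hs. H h (hd xs) (tl xs) \<noteq> 0
      then G (hd xs) (map (\<lambda>h. H h (hd xs) (tl xs) - 1) hs) else 0)"
    by (simp add: o_def cong: if_cong)
next
  fix xs s y
  assume len: "length xs = n" and eq: "(if \<forall>h\<in>set hs. H h s xs \<noteq> 0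
      then G s (map (\<lambda>h. H h s xs - 1) hs) else 0) = Suc y"
  then have nz: "\<forall>h\<in>set hs. H h s xs \<noteq> 0" and g: "G s (map (\<lambda>h. H h s xs - 1) hs) = Suc y"
    by (auto split: if_splits)
  have val: "h xs = Some (H h s xs - 1)" if "h \<in> set hs" for h
    using stages_sound[OF H[OF that], of s xs "H h s xs - 1"] nz that len by auto
  then have "map (\<lambda>h. the (h xs)) hs = map (\<lambda>h. H h s xs - 1) hs"
    by (intro map_cong refl) (metis option.sel)
  moreover have "\<forall>h\<in>set hs. xs \<in> dom h" using val by blast
  moreover have "g (map (\<lambda>h. H h s xs - 1) hs) = Some y" using stages_sound[OF G g] by simp
  ultimately show "comp_op n g hs xs = Some y" using len by (simp only: comp_op_def) simp
next
  fix xs y assume len: "length xs = n" and eq: "comp_op n g hs xs = Some y"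
  then have d: "\<forall>h\<in>set hs. xs \<in> dom h" and g: "g (map (\<lambda>h. the (h xs)) hs) = Some y"
    by (auto simp: comp_op_def split: if_splits)
  have "\<forall>\<^sub>F s in sequentially. \<forall>h\<in>set hs. H h s xs = Suc (the (h xs))"
  proof (intro eventually_ball_finite ballI)
    fix h assume h: "h \<in> set hs"
    with d have "h xs = Some (the (h xs))" by auto
    from stages_complete[OF H[OF h] this len]
    show "\<forall>\<^sub>F s in sequentially. H h s xs = Suc (the (h xs))" .
  qed simp
  moreover have "\<forall>\<^sub>F s in sequentially. G s (map (\<lambda>h. the (h xs)) hs) = Suc y"
    using stages_complete[OF G g] by simp
  ultimately show "\<forall>\<^sub>F s in sequentially. (if \<forall>h\<in>set hs. H h s xs \<noteq> 0
      then G s (map (\<lambda>h. H h s xs - 1) hs) else 0) = Suc y"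
  proof eventually_elim
    case (elim s)
    from elim have eq: "map (\<lambda>h. H h s xs - 1) hs = map (\<lambda>h. the (h xs)) hs" by simp
    show ?case unfolding eq using elim by simp
  qed
qed

text \<open>The whole recursion is run at one fixed stage, and a missing intermediate value makes
  all later ones missing. A defined value depends on finitely many intermediate ones, all of which
  are correct from some stage on.\<close>

lemma stages_primrec:
  assumes G: "stages n G g" and H: "stages (Suc (Suc n)) H h"
  shows "stages (Suc n)
    (\<lambda>s xs. rec_nat (G s (tl xs)) (\<lambda>k y. if y = 0 then 0 else H s (k # (y - 1) # tl xs)) (hd xs))
    (primrec_op g h)"
proof (rule stagesI)
  \<comment> \<open>The arguments are the counter, the coded previous result, the stage and then the
    parameters: the stage acts as the first parameter of the recursion.\<close>
  let ?h = "\<lambda>xs. if xs ! 1 = 0 then 0 else H (xs ! 2) (xs ! 0 # (xs ! 1 - 1) # drop 3 xs)"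
  have "total_recursive (3 + n) ?h"
    using total_recursive_subst[of "[\<lambda>xs. xs ! 2, \<lambda>xs. xs ! 0, \<lambda>xs. xs ! 1 - 1]" n
        "\<lambda>xs. H (hd xs) (tl xs)" 3] stages_recursive[OF H]
    by (intro total_recursive_if total_recursive_const total_recursive_nth)
      (auto simp del: One_nat_def simp: total_recursive_nth total_recursive_pred numeral_3_eq_3)
  with stages_recursive[OF G] have "total_recursive (Suc (Suc n)) (\<lambda>xs.
      rec_nat (G (hd (tl xs)) (tl (tl xs))) (\<lambda>k y. ?h (k # y # tl xs)) (hd xs))"
    by (intro total_recursive_rec_nat) (auto simp: numeral_3_eq_3)
  then have 1: "total_recursive (2 + n) (\<lambda>xs.
      rec_nat (G (xs ! 1) (drop 2 xs))
        (\<lambda>k y. if y = 0 then 0 else H (xs ! 1) (k # (y - 1) # drop 2 xs)) (hd xs))"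
    unfolding add_2_eq_Suc
    by (rule total_recursive_cong)
      (auto simp: length_Suc_conv numeral_2_eq_2 numeral_3_eq_3 cong: if_cong)
  \<comment> \<open>The first two arguments are exchanged, so that the stage precedes the recursion
    argument.\<close>
  have "total_recursive (2 + n) (\<lambda>xs.
      rec_nat (G ((map (\<lambda>e. e xs) [\<lambda>xs. xs ! 1, \<lambda>xs. xs ! 0] @ drop 2 xs) ! 1)
         (drop 2 (map (\<lambda>e. e xs) [\<lambda>xs. xs ! 1, \<lambda>xs. xs ! 0] @ drop 2 xs)))
        (\<lambda>k y. if y = 0 then 0
          else H ((map (\<lambda>e. e xs) [\<lambda>xs. xs ! 1, \<lambda>xs. xs ! 0] @ drop 2 xs) ! 1)
            (k # (y - 1) # drop 2 (map (\<lambda>e. e xs) [\<lambda>xs. xs ! 1, \<lambda>xs. xs ! 0] @ drop 2 xs)))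
        (hd (map (\<lambda>e. e xs) [\<lambda>xs. xs ! 1, \<lambda>xs. xs ! 0] @ drop 2 xs)))"
    by (rule total_recursive_subst) (use 1 in \<open>auto intro: total_recursive_nth\<close>)
  then show "total_recursive (Suc (Suc n)) (\<lambda>xs. rec_nat (G (hd xs) (tl (tl xs)))
      (\<lambda>k y. if y = 0 then 0 else H (hd xs) (k # (y - 1) # tl (tl xs))) (hd (tl xs)))"
    unfolding add_2_eq_Suc
    by (rule total_recursive_cong) (auto simp: length_Suc_conv cong: if_cong)
next
  fix xs s y
  assume "length xs = Suc n" and eq: "rec_nat (G s (tl xs))
      (\<lambda>k y. if y = 0 then 0 else H s (k # (y - 1) # tl xs)) (hd xs) = Suc y"
  then obtain k ys where xs: "xs = k # ys" and len: "length ys = n" by (cases xs) auto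
  have "rec_nat (G s ys) (\<lambda>k y. if y = 0 then 0 else H s (k # (y - 1) # ys)) k = Suc y \<Longrightarrow>
      primrec_op g h (k # ys) = Some y" for y
  proof (induction k arbitrary: y)
    case 0
    then show ?case using stages_sound[OF G] len by simp
  next
    case (Suc k)
    let ?r = "rec_nat (G s ys) (\<lambda>k y. if y = 0 then 0 else H s (k # (y - 1) # ys)) k"
    from Suc.prems have nz: "?r \<noteq> 0" and h: "H s (k # (?r - 1) # ys) = Suc y"
      by (auto split: if_splits)
    from Suc.IH[of "?r - 1"] nz have "primrec_op g h (k # ys) = Some (?r - 1)" by simp
    moreover have "h (k # (?r - 1) # ys) = Some y" by (rule stages_sound[OF H h]) (simp add: len)
    ultimately show ?case by simp
  qed
  with eq xs show "primrec_op g h xs = Some y" by (simp cong: if_cong)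
next
  fix xs y
  assume "length xs = Suc n" and eq: "primrec_op g h xs = Some y"
  then obtain k ys where xs: "xs = k # ys" and len: "length ys = n" by (cases xs) auto
  have "primrec_op g h (k # ys) = Some y \<Longrightarrow> \<forall>\<^sub>F s in sequentially.
      rec_nat (G s ys) (\<lambda>k y. if y = 0 then 0 else H s (k # (y - 1) # ys)) k = Suc y" for y
  proof (induction k arbitrary: y)
    case 0
    then show ?case using stages_complete[OF G] len by simp
  next
    case (Suc k)
    then obtain z where z: "primrec_op g h (k # ys) = Some z" "h (k # z # ys) = Some y"
      by (auto split: option.splits)
    have "\<forall>\<^sub>F s in sequentially. H s (k # z # ys) = Suc y"
      by (rule stages_complete[OF H z(2)]) (simp add: len)
    with Suc.IH[OF z(1)] show ?case by eventually_elim simp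
  qed
  with eq xs show "\<forall>\<^sub>F s in sequentially. rec_nat (G s (tl xs))
      (\<lambda>k y. if y = 0 then 0 else H s (k # (y - 1) # tl xs)) (hd xs) = Suc y"
    by (simp cong: if_cong)
qed

section \<open>Stage approximations of minimization\<close>

text \<open>
  Looks for the first \<open>k\<close> with \<open>c k = 1\<close>, all earlier values being greater than \<open>1\<close>. The result \<open>0\<close>
  means that the search is still running, \<open>1\<close> that it met a \<open>c k = 0\<close>, and \<open>Suc (Suc k)\<close> that it
  found \<open>k\<close>.
\<close>

definition search :: "(nat \<Rightarrow> nat) \<Rightarrow> nat \<Rightarrow> nat" where
  "search c = rec_nat 0 (\<lambda>k y. if y = 0
     then if c k = 0 then 1 else if c k - 1 = 0 then Suc (Suc k) else 0 else y)"

lemma search_eq_0: "search c k = 0 \<longleftrightarrow> (\<forall>j<k. 1 < c j)"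
  by (induction k) (auto simp: search_def less_Suc_eq)

text \<open>A nonzero result of \<open>search\<close> is never changed again, so
  \<open>Suc (Suc m)\<close> can only have been entered at step \<open>m\<close>, while the search
  was still running.\<close>

lemma search_eq_Suc_Suc:
  "search c k = Suc (Suc m) \<longleftrightarrow> m < k \<and> c m = 1 \<and> (\<forall>j<m. 1 < c j)"
proof (induction k)
  case (Suc k)
  show ?case
  proof (cases "search c k = 0")
    case True
    then have "search c (Suc k) = (if c k = 0 then 1 else if c k - 1 = 0 then Suc (Suc k) else 0)"
      by (simp add: search_def)
    with True show ?thesis by (auto simp: search_eq_0 less_Suc_eq)
  next
    case False
    then have "search c (Suc k) = search c k" by (simp add: search_def)
    moreover from False obtain j where "j < k" "\<not> 1 < c j" by (auto simp: search_eq_0)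
    ultimately show ?thesis using Suc.IH by (auto simp: less_Suc_eq)
  qed
qed (simp add: search_def)

lemma mu_op_eq_Some:
  "mu_op n f xs = Some m \<longleftrightarrow>
     length xs = n \<and> f (m # xs) = Some 0 \<and> (\<forall>j<m. \<exists>y>0. f (j # xs) = Some y)"
proof
  assume *: "mu_op n f xs = Some m"
  then obtain k where k: "f (k # xs) = Some 0" "\<forall>j<k. f (j # xs) \<noteq> None"
    and len: "length xs = n" and m: "m = (LEAST k. f (k # xs) = Some 0)"
    by (auto simp: mu_op_def split: if_splits)
  have "f (m # xs) = Some 0" "m \<le> k" unfolding m using k(1) by (auto intro: LeastI Least_le)
  moreover have "f (j # xs) \<noteq> Some 0" if "j < m" for j
    using that not_less_Least unfolding m by blast
  ultimately show "length xs = n \<and> f (m # xs) = Some 0 \<and> (\<forall>j<m. \<exists>y>0. f (j # xs) = Some y)"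
    using k(2) len by (metis gr0I less_le_trans not_None_eq)
next
  assume *: "length xs = n \<and> f (m # xs) = Some 0 \<and> (\<forall>j<m. \<exists>y>0. f (j # xs) = Some y)"
  then have "(LEAST k. f (k # xs) = Some 0) = m"
    by (intro Least_equality) (auto simp: not_less[symmetric])
  with * show "mu_op n f xs = Some m" unfolding mu_op_def by fastforce
qed

text \<open>Stage \<open>s\<close> searches below \<open>s\<close> among the approximations of stage
  \<open>s\<close>: there \<open>1\<close> codes the value zero and larger numbers code positive
  values. The final \<open>- 1\<close> merges "still running" and "met an undetermined value" into
  "no result yet" and turns \<open>Suc (Suc k)\<close> into the code of \<open>k\<close>.\<close>

lemma stages_mu:
  assumes F: "stages (Suc n) F f"
  shows "stages n (\<lambda>s xs. search (\<lambda>k. F s (k # xs)) s - 1) (mu_op n f)"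
proof (rule stagesI)
  let ?F = "\<lambda>xs. F (xs ! 2) (xs ! 0 # drop 3 xs)"
  let ?h = "\<lambda>xs. if xs ! 1 = 0 then if ?F xs = 0 then 1 else if ?F xs - 1 = 0
      then Suc (Suc (xs ! 0)) else 0 else xs ! 1"
  have "total_recursive (3 + n) ?F"
    using total_recursive_subst[of "[\<lambda>xs. xs ! 2, \<lambda>xs. xs ! 0]" n
        "\<lambda>xs. F (hd xs) (tl xs)" 3] stages_recursive[OF F]
    by (auto simp: total_recursive_nth)
  then have "total_recursive (3 + n) ?h"
    by (intro total_recursive_if total_recursive_const total_recursive_nth total_recursive_Suc
        total_recursive_pred) auto
  then have "total_recursive (Suc (Suc n)) (\<lambda>xs.
      rec_nat 0 (\<lambda>k y. ?h (k # y # tl xs)) (hd xs))"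
    by (intro total_recursive_rec_nat total_recursive_const) (auto simp: numeral_3_eq_3)
  then have "total_recursive (Suc (Suc n)) (\<lambda>xs. search (\<lambda>k. F (xs ! 1) (k # drop 2 xs)) (hd xs))"
    unfolding search_def
    by (rule total_recursive_cong)
      (auto simp: length_Suc_conv numeral_2_eq_2 numeral_3_eq_3 cong: if_cong)
  \<comment> \<open>The stage is duplicated: one copy bounds the search, the other selects the
    approximation.\<close>
  then have "total_recursive (1 + n) (\<lambda>xs. search
      (\<lambda>k. F ((map (\<lambda>e. e xs) [hd, hd] @ drop 1 xs) ! 1)
        (k # drop 2 (map (\<lambda>e. e xs) [hd, hd] @ drop 1 xs)))
      (hd (map (\<lambda>e. e xs) [hd, hd] @ drop 1 xs)))"
    by (intro total_recursive_subst) (auto simp: total_recursive_hd)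
  then show "total_recursive (Suc n) (\<lambda>xs. search (\<lambda>k. F (hd xs) (k # tl xs)) (hd xs) - 1)"
    by (intro total_recursive_pred) (simp add: drop_Suc)
next
  fix xs s m
  assume len: "length xs = n" and "search (\<lambda>k. F s (k # xs)) s - 1 = Suc m"
  then have "search (\<lambda>k. F s (k # xs)) s = Suc (Suc m)" by simp
  then have m: "F s (m # xs) = Suc 0" and j: "\<And>j. j < m \<Longrightarrow> 1 < F s (j # xs)"
    by (auto simp: search_eq_Suc_Suc)
  have "\<exists>y>0. f (j # xs) = Some y" if "j < m" for j
    using stages_sound[OF F, of s "j # xs" "F s (j # xs) - 1"] j[OF that] len by auto
  with m len stages_sound[OF F m] show "mu_op n f xs = Some m"
    by (auto simp: mu_op_eq_Some)
next
  fix xs m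
  assume len: "length xs = n" and "mu_op n f xs = Some m"
  then have m: "f (m # xs) = Some 0" and j: "\<forall>j<m. \<exists>y>0. f (j # xs) = Some y"
    by (auto simp: mu_op_eq_Some)
  have 1: "\<forall>\<^sub>F s in sequentially. F s (m # xs) = Suc 0"
    by (rule stages_complete[OF F m]) (simp add: len)
  have 2: "\<forall>\<^sub>F s in sequentially. \<forall>j\<in>{..<m}. 1 < F s (j # xs)"
  proof (rule eventually_ball_finite, simp, rule ballI)
    fix j' assume "j' \<in> {..<m}"
    with j obtain y where y: "y > 0" "f (j' # xs) = Some y" by auto
    have "\<forall>\<^sub>F s in sequentially. F s (j' # xs) = Suc y"
      by (rule stages_complete[OF F y(2)]) (simp add: len)
    then show "\<forall>\<^sub>F s in sequentially. 1 < F s (j' # xs)"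
      by eventually_elim (use y in auto)
  qed
  \<comment> \<open>The finitely many values up to index \<open>m\<close> are settled from some
    stage on; in addition \<open>m < s\<close> is required, since stage \<open>s\<close> inspects
    only indices below \<open>s\<close>.\<close>
  show "\<forall>\<^sub>F s in sequentially. search (\<lambda>k. F s (k # xs)) s - 1 = Suc m"
    using 1 2 eventually_gt_at_top[of m]
  proof eventually_elim
    case (elim s)
    then have "search (\<lambda>k. F s (k # xs)) s = Suc (Suc m)" by (auto simp: search_eq_Suc_Suc)
    then show ?case by simp
  qed
qed

text \<open>Takes the place of a normal form theorem: instead of coding computations, each formation
  rule is shown to carry stage functions to stage functions.\<close>

lemma partial_recursive_stages: "partial_recursive n f \<Longrightarrow> \<exists>F. stages n F f"
proof (induction rule: partial_recursive.induct)
  case (zero n)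
  show ?case using stages_total[OF total_recursive_const] by blast
next
  case succ
  have "total_recursive 1 (\<lambda>xs. Suc (xs ! 0))"
    by (intro total_recursive_Suc total_recursive_nth) simp
  from stages_total[OF this] show ?case by blast
next
  case (proj i n)
  then show ?case using stages_total[OF total_recursive_nth] by blast
next
  case (comp hs g n)
  from comp.IH(1) obtain G where "stages (length hs) G g" by blast
  moreover obtain H where "\<forall>h\<in>set hs. stages n (H h) h" using comp.IH(2) by metis
  ultimately show ?case using stages_comp by blast
next
  case (prim_rec n g h)
  then show ?case using stages_primrec by blast
next
  case (mu n f)
  then show ?case using stages_mu by blast
qed

section \<open>Parallel search, agreement and recursively enumerable sets\<close>

lemma partial_recursive_total:
  "total_recursive n F \<Longrightarrow>
    partial_recursive n (\<lambda>xs. if length xs = n then Some (F xs) else None)"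
  by (simp add: total_recursive_def)

text \<open>Both functions are run in parallel and the first result to appear is output.
  Minimization over stages cannot get stuck, because stage functions are total.\<close>

lemma partial_recursive_select:
  assumes "partial_recursive n f1" "partial_recursive n f2"
  shows "\<exists>g. partial_recursive n g \<and> dom g = dom f1 \<union> dom f2 \<and> (\<forall>x. g x = f1 x \<or> g x = f2 x)"
proof -
  obtain F1 where F1: "stages n F1 f1" using assms(1) partial_recursive_stages by blast
  obtain F2 where F2: "stages n F2 f2" using assms(2) partial_recursive_stages by blast
  \<comment> \<open>If both functions have results at the same stage, \<open>f1\<close> takes
    precedence.\<close>
  define S where "S xs = (if F1 (hd xs) (tl xs) = 0 then F2 (hd xs) (tl xs) else F1 (hd xs) (tl xs))"
    for xs
  have S: "total_recursive (Suc n) S"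
    unfolding S_def by (intro total_recursive_if stages_recursive[OF F1] stages_recursive[OF F2])
  have S_sound: "f1 xs = Some y \<or> f2 xs = Some y" if "S (s # xs) = Suc y" "length xs = n" for s xs y
    using that stages_sound[OF F1] stages_sound[OF F2] by (auto simp: S_def split: if_splits)
  have S_complete: "\<exists>s. S (s # xs) \<noteq> 0" if xs: "xs \<in> dom f1 \<union> dom f2" for xs
  proof -
    have len: "length xs = n"
      using xs dom_partial_recursive assms by (auto simp: tuples_def)
    have "\<exists>s. F1 s xs \<noteq> 0" if d: "xs \<in> dom f1"
    proof -
      from d obtain y where "f1 xs = Some y" by blast
      from stages_complete[OF F1 this len] have "\<exists>s. F1 s xs = Suc y"
        by (rule eventually_happens'[OF sequentially_bot])
      then show ?thesis by (metis nat.distinct(1))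
    qed
    moreover have "\<exists>s. F2 s xs \<noteq> 0" if d: "xs \<in> dom f2"
    proof -
      from d obtain y where "f2 xs = Some y" by blast
      from stages_complete[OF F2 this len] have "\<exists>s. F2 s xs = Suc y"
        by (rule eventually_happens'[OF sequentially_bot])
      then show ?thesis by (metis nat.distinct(1))
    qed
    ultimately obtain s where "F1 s xs \<noteq> 0 \<or> F2 s xs \<noteq> 0" using xs by blast
    then show ?thesis by (intro exI[of _ s]) (auto simp: S_def)
  qed
  \<comment> \<open>\<open>?Z\<close> vanishes exactly at the stages with a result, so minimization
    finds the first of them. \<open>?T\<close> decodes the result there; the projections
    \<open>?ps\<close> hand it the original input.\<close>
  let ?Z = "\<lambda>xs. if length xs = Suc n then Some (if S xs = 0 then 1 else 0) else None"
  let ?T = "\<lambda>xs. if length xs = Suc n then Some (S xs - 1) else None"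
  let ?ps = "map (\<lambda>i xs. if length xs = n then Some (xs ! i) else None) [0..<n]"
  define g where "g = comp_op n ?T (mu_op n ?Z # ?ps)"
  have g_rec: "partial_recursive n g"
    unfolding g_def
  proof (rule partial_recursive.comp)
    show "partial_recursive (length (mu_op n ?Z # ?ps)) ?T"
      using S partial_recursive_total total_recursive_pred by simp
    have "partial_recursive n (mu_op n ?Z)"
      by (intro partial_recursive.mu partial_recursive_total total_recursive_if S
          total_recursive_const)
    then show "partial_recursive n h" if "h \<in> set (mu_op n ?Z # ?ps)" for h
      using that by (auto intro: partial_recursive.proj)
  qed
  have g_sound: "g xs = f1 xs \<or> g xs = f2 xs" if "xs \<in> dom g" for xs
  proof -
    from that have len: "length xs = n" and d: "xs \<in> dom (mu_op n ?Z)"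
      by (auto simp: g_def comp_op_def split: if_splits)
    then obtain s where s: "mu_op n ?Z xs = Some s" by blast
    have ps: "map (\<lambda>h. the (h xs)) ?ps = xs"
      using len by (intro nth_equalityI) auto
    from that s have "g xs = ?T (s # map (\<lambda>h. the (h xs)) ?ps)"
      by (auto simp: g_def comp_op_def split: if_splits)
    then have "g xs = Some (S (s # xs) - 1)" unfolding ps by (simp add: len)
    moreover have "S (s # xs) \<noteq> 0" using s by (auto simp: mu_op_eq_Some split: if_splits)
    ultimately show ?thesis using S_sound[of s xs "S (s # xs) - 1"] len by auto
  qed
  have g_dom: "xs \<in> dom g" if xs: "xs \<in> dom f1 \<union> dom f2" for xs
  proof -
    have len: "length xs = n"
      using xs dom_partial_recursive assms by (auto simp: tuples_def)
    define s where "s = (LEAST s. S (s # xs) \<noteq> 0)"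
    have "S (s # xs) \<noteq> 0" unfolding s_def using S_complete[OF xs] by (rule LeastI_ex)
    moreover have "S (j # xs) = 0" if "j < s" for j using that not_less_Least unfolding s_def by blast
    ultimately have "mu_op n ?Z xs = Some s" using len by (auto simp: mu_op_eq_Some)
    then show ?thesis using len by (auto simp: g_def comp_op_def dom_def)
  qed
  have "g xs = f1 xs \<or> g xs = f2 xs" for xs
  proof (cases "xs \<in> dom g")
    case False
    \<comment> \<open>Off \<open>dom g\<close> both functions are undefined, so the equation holds
      with \<open>None\<close> on both sides.\<close>
    with g_dom[of xs] have "xs \<notin> dom f1" by blast
    with False have "g xs = f1 xs" unfolding domIff by simp
    then show ?thesis ..
  qed (rule g_sound)
  moreover have "xs \<in> dom g \<longleftrightarrow> xs \<in> dom f1 \<union> dom f2" for xs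
  proof
    assume "xs \<in> dom g"
    with g_sound[of xs] show "xs \<in> dom f1 \<union> dom f2" unfolding Un_iff domIff by metis
  qed (rule g_dom)
  ultimately show ?thesis using g_rec by blast
qed

lemma partial_recursive_select_finite:
  assumes "finite I" "\<And>i. i \<in> I \<Longrightarrow> partial_recursive n (f i)"
  shows "\<exists>g. partial_recursive n g \<and> dom g = (\<Union>i\<in>I. dom (f i)) \<and>
    (\<forall>x\<in>dom g. \<exists>i\<in>I. g x = f i x)"
  using assms
proof (induction I)
  case empty
  \<comment> \<open>Minimizing the constant \<open>1\<close> never halts and gives the empty
    function.\<close>
  have "partial_recursive n (mu_op n (\<lambda>xs. if length xs = Suc n then Some 1 else None))"
    by (intro partial_recursive.mu partial_recursive_total total_recursive_const)
  moreover have "dom (mu_op n (\<lambda>xs. if length xs = Suc n then Some 1 else None)) = {}"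
    by (auto simp: mu_op_eq_Some dom_def split: if_splits)
  ultimately show ?case by fastforce
next
  case (insert i I)
  then obtain g where g: "partial_recursive n g" "dom g = (\<Union>i\<in>I. dom (f i))"
      "\<forall>x\<in>dom g. \<exists>i\<in>I. g x = f i x" by auto
  have "partial_recursive n (f i)" using insert.prems by simp
  from partial_recursive_select[OF this g(1)] obtain g' where g': "partial_recursive n g'"
      "dom g' = dom (f i) \<union> dom g" "\<forall>x. g' x = f i x \<or> g' x = g x" by blast
  \<comment> \<open>If \<open>g' x\<close> comes from \<open>g\<close>, it is defined, so
    \<open>x\<close> lies in \<open>dom g\<close> and the induction hypothesis applies.\<close>
  have "\<exists>j\<in>insert i I. g' x = f j x" if "x \<in> dom g'" for x
    using that g' g(3) by (metis domIff insert_iff)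
  with g'(1,2) g(2) show ?case by (intro exI[of _ g'] conjI ballI) auto
qed

text \<open>Minimizing a function that ignores the search variable gives a semi-test: the search
  halts at once if the two values are equal, and never otherwise. Strict composition adds this test
  to the domain, and projection keeps the value of \<open>f\<close>.\<close>

lemma partial_recursive_agree:
  assumes "partial_recursive n f" "partial_recursive n g"
  shows "partial_recursive n (\<lambda>xs. if f xs = g xs then f xs else None)"
proof -
  \<comment> \<open>Truncated subtraction in both directions: the value is zero exactly if arguments
    \<open>1\<close> and \<open>2\<close> are equal. Argument \<open>0\<close> is the search
    variable.\<close>
  let ?D = "\<lambda>xs. if length xs = Suc 2
    then Some (if xs ! 1 - xs ! 2 = 0 then xs ! 2 - xs ! 1 else 1) else None"
  let ?P = "\<lambda>xs. if length xs = 3 then Some (xs ! 0) else None"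
  let ?E = "comp_op n (mu_op 2 ?D) [f, g]"
  have "partial_recursive 2 (mu_op 2 ?D)"
    by (intro partial_recursive.mu partial_recursive_total total_recursive_if total_recursive_const
        total_recursive_diff total_recursive_nth) auto
  then have "partial_recursive n ?E"
    using assms by (intro partial_recursive.comp) (auto simp: numeral_2_eq_2)
  then have "partial_recursive n (comp_op n ?P [f, g, ?E])"
    using assms partial_recursive.proj[of 0 3]
    by (intro partial_recursive.comp) (auto simp: numeral_3_eq_3)
  also have "comp_op n ?P [f, g, ?E] = (\<lambda>xs. if f xs = g xs then f xs else None)"
  proof
    fix xs
    have E: "?E xs = (if f xs = g xs \<and> xs \<in> dom f then Some 0 else None)"
    proof (cases "length xs = n \<and> xs \<in> dom f \<and> xs \<in> dom g")
      case True
      then obtain a b where ab: "f xs = Some a" "g xs = Some b" by blast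
      with True have eq: "?E xs = mu_op 2 ?D [a, b]" by (auto simp: comp_op_def)
      have "mu_op 2 ?D [a, b] = Some m \<longleftrightarrow> a = b \<and> m = 0" for m
        by (cases m) (auto simp: mu_op_eq_Some split: if_splits)
      then have "mu_op 2 ?D [a, b] = (if a = b then Some 0 else None)"
        by (cases "mu_op 2 ?D [a, b]") auto
      with eq ab show ?thesis by auto
    next
      case False
      then have "?E xs = None" by (auto simp: comp_op_def)
      moreover have "xs \<notin> dom f \<or> xs \<notin> dom g"
        using False dom_partial_recursive assms by (auto simp: tuples_def)
      ultimately show ?thesis by (auto simp: dom_def)
    qed
    have "length xs = n" if "xs \<in> dom f"
      using that dom_partial_recursive assms by (auto simp: tuples_def)
    with E show "comp_op n ?P [f, g, ?E] xs = (if f xs = g xs then f xs else None)"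
      by (auto simp: comp_op_def[of n ?P] dom_def)
  qed
  finally show ?thesis .
qed

text \<open>Nonemptiness matters: for empty \<open>I\<close> the right-hand side would hold for
  every \<open>y\<close> at once.\<close>

lemma partial_recursive_agree_finite:
  assumes "finite I" "I \<noteq> {}" "\<And>i. i \<in> I \<Longrightarrow> partial_recursive n (f i)"
  shows "\<exists>g. partial_recursive n g \<and> (\<forall>x y. g x = Some y \<longleftrightarrow> (\<forall>i\<in>I. f i x = Some y))"
  using assms
proof (induction I rule: finite_ne_induct)
  case (singleton i)
  then show ?case by auto
next
  case (insert i I)
  then obtain g where g: "partial_recursive n g"
      "\<forall>x y. g x = Some y \<longleftrightarrow> (\<forall>i\<in>I. f i x = Some y)" by auto
  have "partial_recursive n (f i)" using insert.prems by simp
  from partial_recursive_agree[OF this g(1)] show ?case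
  proof (intro exI conjI allI)
    show "(if f i x = g x then f i x else None) = Some y \<longleftrightarrow> (\<forall>j\<in>insert i I. f j x = Some y)"
      for x y
      unfolding ball_simps g(2)[rule_format, symmetric] by auto
  qed
qed

text \<open>Strictness of composition does the work: projecting the pair of \<open>f\<close> and
  \<open>d\<close> to \<open>f\<close> discards the value of \<open>d\<close> but still demands that
  it be defined.\<close>

lemma partial_recursive_restrict:
  assumes "partial_recursive n f" "recursively_enumerable n H"
  shows "partial_recursive n (f |` H)"
proof -
  obtain d where d: "partial_recursive n d" "H = dom d"
    using assms(2) by (auto simp: recursively_enumerable_def)
  let ?P = "\<lambda>xs. if length xs = 2 then Some (xs ! 0) else None"
  have "partial_recursive n (comp_op n ?P [f, d])"
    using assms(1) d(1) partial_recursive.proj[of 0 2]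
    by (intro partial_recursive.comp) (auto simp: numeral_2_eq_2)
  also have "comp_op n ?P [f, d] = f |` H"
  proof
    fix xs
    have "length xs = n" if "xs \<in> dom f"
      using that dom_partial_recursive[OF assms(1)] by (auto simp: tuples_def)
    then show "comp_op n ?P [f, d] xs = (f |` H) xs"
      by (cases "f xs") (auto simp: comp_op_def d(2) restrict_map_def)
  qed
  finally show ?thesis .
qed

text \<open>Minimization over a dummy variable halts exactly where \<open>g\<close> is zero: a
  positive value makes the search endless, an undefined one blocks it. The projections
  \<open>?ps\<close> drop the dummy.\<close>

lemma recursively_enumerable_zeros:
  assumes "partial_recursive n g"
  shows "recursively_enumerable n {xs. g xs = Some 0}"
proof -
  let ?ps = "map (\<lambda>i xs. if length xs = Suc n then Some (xs ! i) else None) [1..<Suc n]"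
  let ?f = "comp_op (Suc n) g ?ps"
  have "partial_recursive n (mu_op n ?f)"
  proof (intro partial_recursive.mu partial_recursive.comp)
    show "partial_recursive (length ?ps) g" using assms by (simp del: upt_Suc)
    show "partial_recursive (Suc n) h" if "h \<in> set ?ps" for h
      using that by (auto intro: partial_recursive.proj simp del: upt_Suc)
  qed
  moreover have "dom (mu_op n ?f) = {xs. g xs = Some 0}"
  proof -
    have f: "?f (k # xs) = g xs" if "length xs = n" for k xs
    proof -
      have "map (\<lambda>h. the (h (k # xs))) ?ps = xs"
        using that by (intro nth_equalityI) (auto simp del: upt_Suc)
      moreover have "\<forall>h\<in>set ?ps. k # xs \<in> dom h" using that by auto
      ultimately show ?thesis using that by (simp only: comp_op_def) simp
    qed
    have "xs \<in> dom (mu_op n ?f) \<longleftrightarrow> g xs = Some 0" for xs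
    proof
      assume "xs \<in> dom (mu_op n ?f)"
      then show "g xs = Some 0" using f by (auto simp: mu_op_eq_Some simp del: upt_Suc)
    next
      assume *: "g xs = Some 0"
      then have "length xs = n" using dom_partial_recursive[OF assms] by (auto simp: tuples_def)
      with * f have "mu_op n ?f xs = Some 0" by (auto simp: mu_op_eq_Some simp del: upt_Suc)
      then show "xs \<in> dom (mu_op n ?f)" by blast
    qed
    then show ?thesis by blast
  qed
  ultimately show ?thesis by (auto simp: recursively_enumerable_def)
qed

section \<open>Potentially partial recursive functions and the two implications\<close>

lemma potentially_partial_recursive_iff:
  "potentially_partial_recursive n f \<longleftrightarrow> (\<exists>g. partial_recursive n g \<and> f \<subseteq>\<^sub>m g)"
proof
  assume "\<exists>g. partial_recursive n g \<and> f \<subseteq>\<^sub>m g"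
  then obtain g where g: "partial_recursive n g" "f \<subseteq>\<^sub>m g" by blast
  have "f = g |` dom f"
    using g(2) by (auto simp: map_le_def restrict_map_def fun_eq_iff domIff)
  with g(1) show "potentially_partial_recursive n f"
    unfolding potentially_partial_recursive_def by blast
next
  assume "potentially_partial_recursive n f"
  then obtain g D where "partial_recursive n g" "f = g |` D"
    unfolding potentially_partial_recursive_def by blast
  then show "\<exists>g. partial_recursive n g \<and> f \<subseteq>\<^sub>m g"
    by (intro exI[of _ g]) (auto simp: map_le_def restrict_map_def split: if_splits)
qed

lemma strongly_join_permitting_imp_separable:
  assumes "strongly_join_permitting {f. potentially_partial_recursive n f} \<A>"
    and sub: "\<And>A. A \<in> \<A> \<Longrightarrow> A \<subseteq> tuples n" and "\<K> \<subseteq> \<A>"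
  shows "\<exists>H. H \<subseteq> tuples n \<and> recursively_enumerable n H \<and>
    separates H (\<Union>\<K> - \<Union>(\<A> - \<K>)) (\<Union>(\<A> - \<K>) - \<Union>\<K>)"
proof -
  let ?P = "\<Union>\<K> - \<Union>(\<A> - \<K>)" and ?Q = "\<Union>(\<A> - \<K>) - \<Union>\<K>"
  define f :: "nat list \<rightharpoonup> nat"
    where "f x = (if x \<in> ?P then Some 0 else if x \<in> ?Q then Some 1 else None)" for x
  have const: "partial_recursive n (\<lambda>xs. if length xs = n then Some c else None)" for c
    by (intro partial_recursive_total total_recursive_const)
  have "potentially_partial_recursive n (f |` A)" if "A \<in> \<A>" for A
  proof -
    let ?c = "if A \<in> \<K> then 0 else 1 :: nat"
    have "f |` A \<subseteq>\<^sub>m (\<lambda>xs. if length xs = n then Some ?c else None)"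
      using that sub[OF that]
      by (auto simp: map_le_def restrict_map_def f_def tuples_def split: if_splits)
    with const show ?thesis unfolding potentially_partial_recursive_iff by blast
  qed
  moreover have "dom f \<subseteq> \<Union>\<A>"
    using assms(3) unfolding f_def by (fastforce split: if_splits)
  ultimately have "potentially_partial_recursive n f"
    using assms(1) by (auto simp: strongly_join_permitting_def)
  then obtain g where g: "partial_recursive n g" "f \<subseteq>\<^sub>m g"
    unfolding potentially_partial_recursive_iff by blast
  have fg: "g x = Some y" if "f x = Some y" for x y
    using g(2) that by (metis domI map_le_def)
  have "?P \<subseteq> {x. g x = Some 0}" by (auto intro!: fg simp: f_def)
  moreover have "g x = Some 1" if "x \<in> ?Q" for x using that by (intro fg) (auto simp: f_def)
  ultimately have "separates {x. g x = Some 0} ?P ?Q"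
    unfolding separates_def by fastforce
  moreover have "{x. g x = Some 0} \<subseteq> tuples n"
    using dom_partial_recursive[OF g(1)] by blast
  ultimately show ?thesis using recursively_enumerable_zeros[OF g(1)] by blast
qed

lemma separable_imp_strongly_join_permitting:
  assumes "finite \<A>"
    and sep: "\<And>\<K>. \<K> \<subseteq> \<A> \<Longrightarrow> \<exists>H. recursively_enumerable n H \<and>
      separates H (\<Union>\<K> - \<Union>(\<A> - \<K>)) (\<Union>(\<A> - \<K>) - \<Union>\<K>)"
  shows "strongly_join_permitting {f. potentially_partial_recursive n f} \<A>"
  unfolding strongly_join_permitting_def mem_Collect_eq
proof (intro allI impI)
  fix f :: "nat list \<rightharpoonup> nat"
  assume dom: "dom f \<subseteq> \<Union>\<A>" and "\<forall>A\<in>\<A>. potentially_partial_recursive n (f |` A)"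
  then obtain G where G: "partial_recursive n (G A)" "f |` A \<subseteq>\<^sub>m G A" if "A \<in> \<A>" for A
    unfolding potentially_partial_recursive_iff by metis
  have val: "G A x = Some y" if "A \<in> \<A>" "x \<in> A" "f x = Some y" for A x y
  proof -
    from that have "(f |` A) x = Some y" by simp
    with G(2)[OF that(1)] show ?thesis by (metis domI map_le_def)
  qed
  obtain H where H: "recursively_enumerable n (H \<K>)"
      "separates (H \<K>) (\<Union>\<K> - \<Union>(\<A> - \<K>)) (\<Union>(\<A> - \<K>) - \<Union>\<K>)" if "\<K> \<subseteq> \<A>" for \<K>
    using sep by metis
  \<comment> \<open>The empty collection is left out because it determines no value.\<close>
  define I where "I = Pow \<A> - {{}}"
  have "\<exists>g. partial_recursive n g \<and> (\<forall>x y. g x = Some y \<longleftrightarrow> (\<forall>A\<in>\<K>. G A x = Some y))"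
    if "\<K> \<in> I" for \<K>
    using that assms(1) G(1)
    by (intro partial_recursive_agree_finite) (auto simp: I_def intro: finite_subset)
  then obtain g where g: "partial_recursive n (g \<K>)"
      "g \<K> x = Some y \<longleftrightarrow> (\<forall>A\<in>\<K>. G A x = Some y)" if "\<K> \<in> I" for \<K> x y
    by metis
  have "partial_recursive n (g \<K> |` H \<K>)" if "\<K> \<in> I" for \<K>
    using that g(1) H(1) by (intro partial_recursive_restrict) (auto simp: I_def)
  moreover have "finite I" using assms(1) by (simp add: I_def)
  ultimately obtain h where h: "partial_recursive n h" "dom h = (\<Union>\<K>\<in>I. dom (g \<K> |` H \<K>))"
      "\<forall>x\<in>dom h. \<exists>\<K>\<in>I. h x = (g \<K> |` H \<K>) x"
    using partial_recursive_select_finite[of I n "\<lambda>\<K>. g \<K> |` H \<K>"] by blast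
  have "h x = Some y" if fx: "f x = Some y" for x y
  proof -
    obtain A where A: "A \<in> \<A>" "x \<in> A" using fx dom by blast
    \<comment> \<open>Every member of \<open>\<A>\<close> containing \<open>x\<close> satisfies this
      condition, so \<open>x\<close> lies in the part that \<open>H \<K>\<close> must cover.\<close>
    define \<K> where "\<K> = {A \<in> \<A>. G A x = Some y}"
    have "\<K> \<in> I" "\<K> \<subseteq> \<A>" using val[OF A fx] A by (auto simp: \<K>_def I_def)
    moreover have "x \<in> \<Union>\<K> - \<Union>(\<A> - \<K>)" using A val fx by (auto simp: \<K>_def)
    then have "x \<in> H \<K>" using H(2)[OF \<open>\<K> \<subseteq> \<A>\<close>] by (auto simp: separates_def)
    moreover have "g \<K> x = Some y" using g(2)[OF \<open>\<K> \<in> I\<close>] by (auto simp: \<K>_def)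
    ultimately have "x \<in> dom h" unfolding h(2) by (auto intro!: bexI[of _ \<K>])
    \<comment> \<open>The search may have stopped at a collection \<open>\<L>\<close> other than
      \<open>\<K>\<close>, so its value \<open>z\<close> has to be compared with \<open>y\<close>. A
      member of \<open>\<L>\<close> containing \<open>x\<close> forces them to be equal.\<close>
    with h(3) obtain \<L> z where L: "\<L> \<in> I" "h x = (g \<L> |` H \<L>) x" "h x = Some z" by blast
    then have xH: "x \<in> H \<L>" and "g \<L> x = Some z"
      by (auto simp: restrict_map_def split: if_splits)
    then have gz: "\<forall>A\<in>\<L>. G A x = Some z" using g(2)[OF L(1)] by simp
    have "\<L> \<subseteq> \<A>" using L(1) by (simp add: I_def)
    have "x \<in> \<Union>\<L>"
    proof (rule ccontr)
      assume "x \<notin> \<Union>\<L>"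
      with A have "x \<in> \<Union>(\<A> - \<L>) - \<Union>\<L>" by blast
      with xH H(2)[OF \<open>\<L> \<subseteq> \<A>\<close>] show False by (auto simp: separates_def)
    qed
    then obtain B where "B \<in> \<L>" "x \<in> B" by blast
    then have "z = y" using gz val[of B x y] fx \<open>\<L> \<subseteq> \<A>\<close> by auto
    with L(3) show ?thesis by simp
  qed
  then have "f \<subseteq>\<^sub>m h" by (auto simp: map_le_def)
  with h(1) show "potentially_partial_recursive n f"
    unfolding potentially_partial_recursive_iff by blast
qed

theorem theorem2p1:
  fixes n :: nat and \<A> :: "nat list set set"
  assumes "n > 0"
    and "finite \<A>"
    and "\<And>A. A \<in> \<A> \<Longrightarrow> A \<subseteq> tuples n"
  shows "strongly_join_permitting {f. potentially_partial_recursive n f} \<A> \<longleftrightarrow>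
    (\<forall>\<K>. \<K> \<subseteq> \<A> \<longrightarrow>
      (\<exists>H. H \<subseteq> tuples n \<and> recursively_enumerable n H \<and>
        separates H (\<Union>\<K> - \<Union>(\<A> - \<K>)) (\<Union>(\<A> - \<K>) - \<Union>\<K>)))"
proof (intro iffI allI impI)
  assume "strongly_join_permitting {f. potentially_partial_recursive n f} \<A>"
  from strongly_join_permitting_imp_separable[OF this assms(3)]
  show "\<exists>H. H \<subseteq> tuples n \<and> recursively_enumerable n H \<and>
      separates H (\<Union>\<K> - \<Union>(\<A> - \<K>)) (\<Union>(\<A> - \<K>) - \<Union>\<K>)" if "\<K> \<subseteq> \<A>" for \<K>
    using that by simp
qed (rule separable_imp_strongly_join_permitting[OF assms(2)], blast)

end
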